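(* Let $k\geq 2$ and $n>18k^{2}-24k+10$ be integers. Then there is no uniquely $C_4^{+}$-saturated graph on $n$ vertices with exactly $k$ triangles.
   Context: All graphs are finite, simple and undirected. $C_4^{+}$ (the diamond) is the graph obtained from a $4$-cycle by adding one chord, i.e. $K_4$ minus an edge. For a graph $H$, a graph $G$ is uniquely $H$-saturated if $G$ contains no subgraph isomorphic to $H$, but for every pair of non-adjacent vertices $u,v$ of $G$, the graph $G+uv$ contains exactly one subgraph isomorphic to $H$. A triangle is a subgraph isomorphic to $K_3$; the number of triangles is the number of such subgraphs. *)

theory Defs
  imports Main
begin

text \<open>A graph is a pair of a vertex set and a set of edges; an edge is a two-element set of vertices.\<close>

type_synonym 'a graph = "'a set \<times> 'a set set"

abbreviation verts :: "'a graph \<Rightarrow> 'a set" where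
  "verts G \<equiv> fst G"

abbreviation edges :: "'a graph \<Rightarrow> 'a set set" where
  "edges G \<equiv> snd G"

definition simple_graph :: "'a graph \<Rightarrow> bool" where
  "simple_graph G \<longleftrightarrow> finite (verts G) \<and> (\<forall>e\<in>edges G. e \<subseteq> verts G \<and> card e = 2)"

definition adjacent :: "'a graph \<Rightarrow> 'a \<Rightarrow> 'a \<Rightarrow> bool" where
  "adjacent G u v \<longleftrightarrow> {u, v} \<in> edges G"

definition subgraph :: "'a graph \<Rightarrow> 'a graph \<Rightarrow> bool" where
  "subgraph S G \<longleftrightarrow> simple_graph S \<and> verts S \<subseteq> verts G \<and> edges S \<subseteq> edges G"

definition isomorphic :: "'a graph \<Rightarrow> 'b graph \<Rightarrow> bool" where
  "isomorphic G H \<longleftrightarrow> (\<exists>f. bij_betw f (verts G) (verts H) \<and>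
     (\<forall>u\<in>verts G. \<forall>v\<in>verts G. adjacent G u v \<longleftrightarrow> adjacent H (f u) (f v)))"

definition add_edge :: "'a graph \<Rightarrow> 'a \<Rightarrow> 'a \<Rightarrow> 'a graph" where
  "add_edge G u v = (verts G, insert {u, v} (edges G))"

text \<open>Subgraphs are not required to be induced, and are counted as subgraphs rather than as embeddings.\<close>

definition copies :: "'b graph \<Rightarrow> 'a graph \<Rightarrow> 'a graph set" where
  "copies H G = {S. subgraph S G \<and> isomorphic S H}"

definition uniquely_saturated :: "'b graph \<Rightarrow> 'a graph \<Rightarrow> bool" where
  "uniquely_saturated H G \<longleftrightarrow> copies H G = {} \<and>
     (\<forall>u\<in>verts G. \<forall>v\<in>verts G. u \<noteq> v \<longrightarrow> \<not> adjacent G u v \<longrightarrow>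
        (\<exists>!S. S \<in> copies H (add_edge G u v)))"

definition complete_graph :: "nat \<Rightarrow> nat graph" where
  "complete_graph n = ({..<n}, {e. e \<subseteq> {..<n} \<and> card e = 2})"

definition cycle4 :: "nat graph" where
  "cycle4 = ({0, 1, 2, 3}, {{0, 1}, {1, 2}, {2, 3}, {3, 0}})"

definition diamond :: "nat graph" where
  "diamond = add_edge cycle4 0 2"

definition triangles :: "'a graph \<Rightarrow> 'a graph set" where
  "triangles G = copies (complete_graph 3) G"

lemma simple_graph_diamond: "simple_graph diamond"
  by (simp add: simple_graph_def diamond_def add_edge_def cycle4_def)

lemma simple_graph_complete_graph: "simple_graph (complete_graph n)"
  by (auto simp: simple_graph_def complete_graph_def)

lemma diamond_eq:
  "diamond = ({0, 1, 2, 3}, {{0, 2}, {0, 1}, {1, 2}, {2, 3}, {3, 0}})"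
  by (simp add: diamond_def add_edge_def cycle4_def)

end

theory Submission
  imports Defs
begin

text \<open>Colour an edge red if it lies on a triangle and blue otherwise. Unique saturation says that
  two non-adjacent vertices have either exactly two common neighbours, joined to them by blue
  edges only, or exactly one, joined by one red and one blue edge. Hence every blue path of length
  two lies on a unique blue 4-cycle, so blue degrees agree at the two ends of a blue edge. Fix a
  triangle \<open>xyz\<close> and suppose that some \<open>w\<close> on no triangle has no neighbour in it. Counting
  paths of length two from \<open>w\<close> to the blue neighbourhood of \<open>x\<close>, with red edges of weight two,
  shows that the degree of \<open>w\<close> exceeds the blue degree of \<open>x\<close> by four, although \<open>w\<close> is joined
  to \<open>x\<close> by a blue path. So all vertices without a neighbour in \<open>xyz\<close> lie on triangles, and
  the blue degrees at \<open>x\<close>, \<open>y\<close>, \<open>z\<close> exceed their number by at most one; this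
  bounds the order of the graph linearly in \<open>k\<close>.\<close>

section \<open>Saturation expressed as axioms on an adjacency relation\<close>

locale diamond_saturated =
  fixes V :: "'a set" and E :: "'a \<Rightarrow> 'a \<Rightarrow> bool"
  assumes finite_V: "finite V"
    and E_sym: "E u v \<Longrightarrow> E v u"
    and E_irrefl: "\<not> E u u"
    and E_V: "E u v \<Longrightarrow> u \<in> V"
    and apex_unique: "\<lbrakk>E u v; E u p; E v p; E u q; E v q\<rbrakk> \<Longrightarrow> p = q"
    \<comment> \<open>A copy created by adding the edge \<open>{u, v}\<close> uses it either as its
      chord, with tips \<open>p\<close> and \<open>q\<close>, or as a side; then the chord is
      \<open>{u, p}\<close> or \<open>{v, p}\<close> and \<open>t\<close> is the tip away from the
      new edge.\<close>
    and common_neighbour: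
      "\<lbrakk>u \<in> V; v \<in> V; u \<noteq> v; \<not> E u v\<rbrakk> \<Longrightarrow>
        (\<exists>p q. p \<noteq> q \<and> E u p \<and> E v p \<and> E u q \<and> E v q) \<or>
        (\<exists>p t. E u p \<and> E v p \<and> E p t \<and> (E u t \<or> E v t))"
    \<comment> \<open>From here on the axioms express uniqueness: a violation would give two copies
      with different vertex sets, or a diamond before the edge is added.\<close>
    and common_neighbours_le_2:
      "\<lbrakk>u \<noteq> v; \<not> E u v; E u p; E v p; E u q; E v q; E u r; E v r\<rbrakk> \<Longrightarrow>
        p = q \<or> p = r \<or> q = r"
    and red_path_unique:
      "\<lbrakk>u \<noteq> v; \<not> E u v; E u p; E v p; E u t; E p t; E u q; E v q\<rbrakk> \<Longrightarrow> p = q"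
    and no_red_red_path:
      "\<lbrakk>u \<noteq> v; \<not> E u v; E u p; E v p; E u t; E p t; E v s; E p s\<rbrakk> \<Longrightarrow> False"
begin

section \<open>Edge colours, weighted paths and blue degrees\<close>

definition nbrs :: "'a \<Rightarrow> 'a set" where
  "nbrs u = {v. E u v}"

definition red :: "'a \<Rightarrow> 'a \<Rightarrow> bool" where
  "red u v \<longleftrightarrow> E u v \<and> (\<exists>t. E u t \<and> E v t)"

definition blue :: "'a \<Rightarrow> 'a \<Rightarrow> bool" where
  "blue u v \<longleftrightarrow> E u v \<and> \<not> red u v"

definition bnbrs :: "'a \<Rightarrow> 'a set" where
  "bnbrs u = {v. blue u v}"

text \<open>The values make a single path with one red edge count as much as two all-blue paths, so
  that both outcomes of saturation have total weight 2.\<close>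

definition weight :: "'a \<Rightarrow> 'a \<Rightarrow> nat" where
  "weight u v = (if red u v then 2 else 1)"

definition triangle :: "'a \<Rightarrow> 'a \<Rightarrow> 'a \<Rightarrow> bool" where
  "triangle x y z \<longleftrightarrow> E x y \<and> E y z \<and> E x z"

definition far :: "'a \<Rightarrow> 'a \<Rightarrow> 'a \<Rightarrow> 'a set" where
  "far x y z = V - {x, y, z} - nbrs x - nbrs y - nbrs z"

definition triangle_verts :: "'a set" where
  "triangle_verts = {u. \<exists>v. red u v}"

lemma E_commute: "E u v \<longleftrightarrow> E v u"
  using E_sym by blast

lemma red_commute: "red u v \<longleftrightarrow> red v u"
  unfolding red_def using E_sym by blast

lemma blue_commute: "blue u v \<longleftrightarrow> blue v u"
  unfolding blue_def using E_commute red_commute by blast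

lemma finite_nbrs: "finite (nbrs u)"
  by (rule finite_subset[OF _ finite_V]) (auto simp: nbrs_def dest: E_sym E_V)

lemma bnbrs_subset_nbrs: "bnbrs u \<subseteq> nbrs u"
  by (auto simp: bnbrs_def nbrs_def blue_def)

lemma finite_bnbrs: "finite (bnbrs u)"
  using finite_subset[OF bnbrs_subset_nbrs finite_nbrs] .

lemma finite_far: "finite (far x y z)"
  unfolding far_def using finite_V by simp

lemma triangle_permute:
  assumes "triangle x y z"
  shows "triangle y z x" "triangle z x y" "triangle x z y"
  using assms E_sym unfolding triangle_def by blast+

lemma far_permute:
  shows "far y z x = far x y z" "far z x y = far x y z"
  unfolding far_def by blast+

text \<open>A triangle on \<open>{u, p}\<close> with apex \<open>t\<close> yields a diamond with
  chord \<open>{u, p}\<close> once \<open>{u, v}\<close> is added. Uniqueness then excludes a second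
  common neighbour as well as a triangle on \<open>{p, v}\<close>.\<close>

lemma red_path:
  assumes "u \<noteq> v" "\<not> E u v" "red u p" "E p v"
  shows "nbrs u \<inter> nbrs v = {p}" "\<not> red p v"
proof -
  obtain t where t: "E u p" "E u t" "E p t"
    using assms(3) unfolding red_def by blast
  have vp: "E v p"
    using assms(4) E_sym by blast
  show "nbrs u \<inter> nbrs v = {p}"
    using red_path_unique[OF assms(1,2) t(1) vp t(2,3)] t(1) vp
    unfolding nbrs_def by blast
  show "\<not> red p v"
    using no_red_red_path[OF assms(1,2) t(1) vp t(2,3)] unfolding red_def by blast
qed

lemma blue_path_nonadjacent:
  assumes "blue u p" "E p v"
  shows "\<not> E u v"
  using assms unfolding blue_def red_def by blast

text \<open>If some path has a red edge, \<open>red_path\<close> makes it the only path, with its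
  other edge blue. Otherwise only the first alternative of \<open>common_neighbour\<close> remains,
  and \<open>common_neighbours_le_2\<close> limits it to two paths.\<close>

lemma weight_sum:
  assumes "u \<in> V" "v \<in> V" "u \<noteq> v" "\<not> E u v"
  shows "(\<Sum>p\<in>nbrs u \<inter> nbrs v. weight u p * weight p v) = 2"
proof (cases "\<exists>p\<in>nbrs u \<inter> nbrs v. red u p \<or> red p v")
  case True
  then obtain p where p: "E u p" "E v p" "red u p \<or> red p v"
    by (auto simp: nbrs_def)
  have nvu: "\<not> E v u"
    using assms(4) E_sym by blast
  have "nbrs u \<inter> nbrs v = {p} \<and> weight u p * weight p v = 2"
  proof (cases "red u p")
    case True
    then show ?thesis
      using red_path[OF assms(3,4) True E_sym[OF p(2)]] by (simp add: weight_def)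
  next
    case False
    then have "red v p"
      using p(3) red_commute by blast
    from red_path[OF assms(3)[symmetric] nvu this E_sym[OF p(1)]] show ?thesis
      using False p(3) by (auto simp: weight_def Int_commute)
  qed
  then show ?thesis
    by simp
next
  case False
  then obtain p q where pq: "p \<noteq> q" "E u p" "E v p" "E u q" "E v q"
    using common_neighbour[OF assms] E_sym unfolding red_def nbrs_def by blast
  have "nbrs u \<inter> nbrs v = {p, q}"
    using common_neighbours_le_2[OF assms(3,4) pq(2-5)] pq unfolding nbrs_def by blast
  then show ?thesis
    using False pq(1) by (auto simp: weight_def)
qed

text \<open>A red edge from \<open>u\<close> or \<open>v\<close> to a common neighbour would make
  that neighbour equal to \<open>p\<close>, whose edges here are blue. So every path has weight 1,
  and the weight sum counts exactly one path besides the one through \<open>p\<close>.\<close>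

lemma blue_path_completion:
  assumes "blue u p" "blue p v" "u \<noteq> v"
  shows "\<exists>!q. q \<noteq> p \<and> blue u q \<and> blue q v"
proof -
  have E: "E u p" "E v p"
    using assms(1,2) E_sym by (auto simp: blue_def)
  have V: "u \<in> V" "v \<in> V"
    using E E_V by blast+
  have n: "\<not> E u v"
    using blue_path_nonadjacent assms(1,2) by (auto simp: blue_def)
  have nvu: "\<not> E v u"
    using n E_sym by blast
  have not_red: "\<not> red u q \<and> \<not> red v q" if "E u q" "E v q" for q
  proof -
    have p: "p \<in> nbrs u \<inter> nbrs v"
      using E by (simp add: nbrs_def)
    have "p = q" if "red u q \<or> red v q"
      using red_path(1)[OF assms(3) n _ E_sym[OF \<open>E v q\<close>]]
        red_path(1)[OF assms(3)[symmetric] nvu _ E_sym[OF \<open>E u q\<close>]] that p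
      by blast
    then show ?thesis
      using assms(1,2) by (auto simp: blue_def red_commute)
  qed
  have "weight u q * weight q v = 1" if "q \<in> nbrs u \<inter> nbrs v" for q
    using not_red that by (auto simp: nbrs_def weight_def red_commute)
  then have "card (nbrs u \<inter> nbrs v) = 2"
    using weight_sum[OF V assms(3) n] by simp
  then have "card (nbrs u \<inter> nbrs v - {p}) = 1"
    using E by (simp add: nbrs_def)
  then obtain q where q: "nbrs u \<inter> nbrs v - {p} = {q}"
    by (auto simp: card_1_singleton_iff)
  have "r \<noteq> p \<and> blue u r \<and> blue r v \<longleftrightarrow> r \<in> nbrs u \<inter> nbrs v - {p}" for r
    using not_red[of r] by (auto simp: nbrs_def blue_def red_commute E_commute)
  then show ?thesis
    unfolding q by simp
qed

text \<open>The blue 4-cycle through \<open>u\<close>, \<open>x\<close>, \<open>v\<close> has a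
  fourth vertex \<open>f v\<close>, a blue neighbour of \<open>u\<close>. This map is injective
  because \<open>v\<close> in turn completes the blue path \<open>f v\<close>, \<open>u\<close>,
  \<open>x\<close>.\<close>

lemma blue_degree_le:
  assumes "blue x u"
  shows "card (bnbrs x) \<le> card (bnbrs u)"
proof -
  define f where "f v = (THE q. q \<noteq> x \<and> blue u q \<and> blue q v)" for v
  have f: "f v \<noteq> x" "blue u (f v)" "blue (f v) v" if "v \<in> bnbrs x - {u}" for v
    using theI'[OF blue_path_completion[of u x v]] assms that
    unfolding f_def by (auto simp: bnbrs_def blue_commute)
  have "inj_on f (bnbrs x - {u})"
  proof (rule inj_onI)
    fix v w assume vw: "v \<in> bnbrs x - {u}" "w \<in> bnbrs x - {u}" "f v = f w"
    have "\<exists>!q. q \<noteq> u \<and> blue (f v) q \<and> blue q x"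
      using blue_path_completion[of "f v" u x] f[OF vw(1)] assms by (simp add: blue_commute)
    then show "v = w"
      using f[OF vw(1)] f[OF vw(2)] vw by (auto simp: bnbrs_def blue_commute)
  qed
  moreover have "f ` (bnbrs x - {u}) \<subseteq> bnbrs u - {x}"
    using f by (auto simp: bnbrs_def)
  ultimately have "card (bnbrs x - {u}) \<le> card (bnbrs u - {x})"
    using card_inj_on_le finite_bnbrs by blast
  moreover have "u \<in> bnbrs x" "x \<in> bnbrs u"
    using assms by (auto simp: bnbrs_def blue_commute)
  ultimately show ?thesis
    using finite_bnbrs by (metis card_Suc_Diff1 Suc_le_mono)
qed

lemma blue_degree_eq: "blue x u \<Longrightarrow> card (bnbrs x) = card (bnbrs u)"
  using blue_degree_le blue_commute by (simp add: le_antisym)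

section \<open>Neighbourhoods around a triangle and the bound on the order\<close>

lemma nbrs_triangle:
  assumes "triangle x y z"
  shows "nbrs x = {y, z} \<union> bnbrs x"
proof -
  have E: "E x y" "E y z" "E x z"
    using assms by (auto simp: triangle_def)
  have "v = z" if "red x v" "v \<noteq> y" for v
  proof (rule apex_unique[OF E(1)])
    have "red x y"
      using E E_sym unfolding red_def by blast
    \<comment> \<open>Otherwise \<open>y\<close>, \<open>x\<close>, \<open>v\<close> would be a path
      of two red edges between non-adjacent vertices.\<close>
    then show "E y v"
      using that red_path(2)[of y v x] E_sym unfolding red_commute[of y x]
      by (auto simp: red_def)
  qed (use that E in \<open>auto simp: red_def\<close>)
  then show ?thesis
    using E by (auto simp: nbrs_def bnbrs_def blue_def)
qed

text \<open>Let \<open>v\<close> be a neighbour of \<open>u\<close> other than \<open>x\<close>. It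
  is not adjacent to \<open>x\<close>, as \<open>{x, u}\<close> is blue. If it were adjacent to
  \<open>y\<close> or \<open>z\<close>, that vertex and \<open>u\<close> would be two common
  neighbours of \<open>x\<close> and \<open>v\<close>, although a red edge joins \<open>x\<close> to
  the former.\<close>

lemma nbrs_of_blue_nbr:
  assumes "triangle x y z" "blue x u"
  shows "nbrs u \<subseteq> insert x (far x y z)"
proof
  fix v assume "v \<in> nbrs u"
  then have uv: "E u v"
    by (simp add: nbrs_def)
  have xv: "\<not> E x v"
    using blue_path_nonadjacent assms(2) uv .
  have "\<not> E s v \<and> v \<noteq> s" if "triangle x s t" "v \<noteq> x" for s t
  proof -
    have E: "E x s" "E s t" "E x t"
      using that(1) by (auto simp: triangle_def)
    have us: "u \<noteq> s"
      using assms(2) E by (auto simp: blue_def red_def)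
    have red: "red x s"
      using E by (auto simp: red_def)
    have "u \<in> nbrs x \<inter> nbrs v"
      using uv assms(2) E_sym by (auto simp: nbrs_def blue_def)
    then have "\<not> E s v"
      using red_path(1)[OF _ xv red] that(2) us by auto
    then show ?thesis
      using E(1) xv by blast
  qed
  from this[OF assms(1)] this[OF triangle_permute(3)[OF assms(1)]]
  show "v \<in> insert x (far x y z)"
    using xv E_V[OF E_sym[OF uv]] by (auto simp: far_def nbrs_def)
qed

text \<open>Since \<open>v\<close> misses \<open>y\<close> and \<open>z\<close>, all its paths of
  length two to \<open>x\<close> end in a blue edge, which contributes the factor 1.\<close>

lemma far_weight_sum:
  assumes "triangle x y z" "v \<in> far x y z"
  shows "(\<Sum>u\<in>nbrs v \<inter> bnbrs x. weight v u) = 2"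
proof -
  have v: "v \<in> V" "x \<in> V" "v \<noteq> x" "\<not> E v x" "\<not> E v y" "\<not> E v z"
    using assms E_V by (auto simp: far_def nbrs_def triangle_def E_commute)
  have "nbrs v \<inter> nbrs x = nbrs v \<inter> bnbrs x"
    using nbrs_triangle[OF assms(1)] v by (auto simp: nbrs_def)
  moreover have "weight u x = 1" if "u \<in> bnbrs x" for u
    using that by (auto simp: bnbrs_def blue_def weight_def red_commute)
  ultimately show ?thesis
    using weight_sum[OF v(1-4)] by simp
qed

lemma far_card_bnbrs:
  assumes "triangle x y z" "w \<in> far x y z" "w \<notin> triangle_verts"
  shows "card (nbrs w \<inter> bnbrs x) = 2"
proof -
  have "weight w u = 1" for u
    using assms(3) by (auto simp: weight_def triangle_verts_def)
  then show ?thesis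
    using far_weight_sum[OF assms(1,2)] by simp
qed

text \<open>Double counting of the weighted edges between \<open>X\<close> and \<open>Y\<close>:
  every vertex on either side sends total weight 2 to the other.\<close>

lemma far_card_far:
  assumes "triangle x y z" "w \<in> far x y z" "w \<notin> triangle_verts"
  shows "card (nbrs w \<inter> far x y z) = card (bnbrs x - nbrs w)"
proof -
  define X where "X = bnbrs x - nbrs w"
  define Y where "Y = nbrs w \<inter> far x y z"
  have fin: "finite X" "finite Y"
    unfolding X_def Y_def using finite_bnbrs finite_far by auto
  have w: "w \<in> V" "\<not> E w x" "w \<noteq> x"
    using assms(2) by (auto simp: far_def nbrs_def E_commute)
  have not_red: "\<not> red w v" for v
    using assms(3) by (auto simp: triangle_verts_def)
  have "(\<Sum>v\<in>{v\<in>Y. E u v}. weight u v) = 2" if u: "u \<in> X" for u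
  proof -
    have xu: "blue x u" "\<not> E w u"
      using u by (auto simp: X_def bnbrs_def nbrs_def)
    have "u \<in> V" "u \<noteq> w"
      using w xu E_V E_sym assms(2) by (auto simp: blue_def far_def nbrs_def)
    then have "(\<Sum>v\<in>nbrs w \<inter> nbrs u. weight w v * weight v u) = 2"
      using weight_sum w(1) xu(2) by blast
    \<comment> \<open>All neighbours of \<open>u\<close> other than \<open>x\<close> are far from
      the triangle, and \<open>w\<close> is not adjacent to \<open>x\<close>.\<close>
    moreover have "nbrs w \<inter> nbrs u = {v\<in>Y. E u v}"
      using nbrs_of_blue_nbr[OF assms(1) xu(1)] w(2) by (auto simp: Y_def nbrs_def)
    moreover have "weight w v * weight v u = weight u v" for v
      using not_red by (simp add: weight_def red_commute)
    ultimately show ?thesis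
      by simp
  qed
  moreover have "(\<Sum>u\<in>{u\<in>X. E u v}. weight u v) = 2" if v: "v \<in> Y" for v
  proof -
    \<comment> \<open>Otherwise \<open>w\<close>, \<open>u\<close>, \<open>v\<close> would form a
      triangle and \<open>{w, v}\<close> would be red. Hence removing \<open>nbrs w\<close> from
      \<open>bnbrs x\<close> loses none of the weight at \<open>v\<close>.\<close>
    have "\<not> E w u" if "E u v" for u
      using not_red[of v] v that E_commute[of u v] unfolding red_def Y_def nbrs_def by blast
    then have "{u\<in>X. E u v} = nbrs v \<inter> bnbrs x"
      by (auto simp: X_def nbrs_def E_commute)
    moreover have "weight u v = weight v u" for u
      by (simp add: weight_def red_commute)
    ultimately show ?thesis
      using far_weight_sum[OF assms(1)] v by (simp add: Y_def)
  qed
  ultimately have "(\<Sum>u\<in>X. 2) = (\<Sum>v\<in>Y. 2::nat)"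
    using sum.swap_restrict[OF fin, of weight E] by simp
  then show ?thesis
    by (simp add: X_def Y_def)
qed

lemma far_subset_triangle_verts:
  assumes "triangle x y z"
  shows "far x y z \<subseteq> triangle_verts"
proof
  fix w assume w: "w \<in> far x y z"
  show "w \<in> triangle_verts"
  proof (rule ccontr)
    assume nw: "w \<notin> triangle_verts"
    note t = assms triangle_permute(1,2)[OF assms]
    have bn: "bnbrs w = nbrs w"
      using nw by (auto simp: bnbrs_def nbrs_def blue_def triangle_verts_def)
    let ?N = "\<lambda>u. nbrs w \<inter> bnbrs u"
    have c: "card (?N x) = 2" "card (?N y) = 2" "card (?N z) = 2"
      using far_card_bnbrs[OF t(1)] far_card_bnbrs[OF t(2)] far_card_bnbrs[OF t(3)] w nw
      by (auto simp: far_permute)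
    \<comment> \<open>A vertex joined by a blue edge to one triangle vertex cannot be adjacent to
      another, so the three blue neighbourhoods are disjoint.\<close>
    have no: "\<not> blue q u" if "blue p u" "E p q" for p q u
      using that blue_path_nonadjacent[of u p q] by (auto simp: blue_def E_commute red_commute)
    have E: "E x y" "E y z" "E x z"
      using assms by (auto simp: triangle_def)
    have "disjnt (?N x) (?N y)" "disjnt (?N x \<union> ?N y) (?N z)"
      "disjnt (?N x \<union> ?N y \<union> ?N z) (nbrs w \<inter> far x y z)"
      using no E by (auto simp: disjnt_iff bnbrs_def far_def nbrs_def blue_def)
    then have "card (?N x \<union> ?N y \<union> ?N z \<union> (nbrs w \<inter> far x y z)) =
        6 + card (nbrs w \<inter> far x y z)"
      using c by (simp add: card_Un_disjnt finite_nbrs)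
    moreover have "card (?N x \<union> ?N y \<union> ?N z \<union> (nbrs w \<inter> far x y z)) \<le> card (nbrs w)"
      by (rule card_mono[OF finite_nbrs]) auto
    ultimately have "card (bnbrs w) \<ge> 6 + card (bnbrs x - nbrs w)"
      using far_card_far[OF assms w nw] bn by simp
    also have "card (bnbrs x - nbrs w) = card (bnbrs x) - 2"
      using c(1) by (simp add: card_Diff_subset_Int finite_nbrs Int_commute)
    \<comment> \<open>Truncated subtraction is harmless: with \<open>d = card (bnbrs x)\<close>, the
      value of \<open>6 + (d - 2)\<close> is at least \<open>d + 4\<close> in any case.\<close>
    finally have "card (bnbrs w) > card (bnbrs x)"
      by linarith
    \<comment> \<open>All edges at \<open>w\<close> are blue, so a vertex of \<open>?N x\<close> is
      the middle of a blue path from \<open>w\<close> to \<open>x\<close>, along which the blue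
      degree is constant.\<close>
    moreover have "?N x \<noteq> {}"
      using c(1) by auto
    then obtain u where "blue x u" "blue w u"
      using bn by (auto simp: bnbrs_def)
    then have "card (bnbrs w) = card (bnbrs x)"
      using blue_degree_eq by simp
    ultimately show False
      by simp
  qed
qed

text \<open>The blue degree is transferred to a blue neighbour \<open>u\<close> of \<open>x\<close>,
  whose neighbours are far from the triangle except for \<open>x\<close> itself; that exception is
  the \<open>Suc\<close>.\<close>

lemma card_bnbrs_le:
  assumes "triangle x y z"
  shows "card (bnbrs x) \<le> Suc (card (far x y z))"
proof (cases "bnbrs x = {}")
  case False
  then obtain u where u: "blue x u"
    by (auto simp: bnbrs_def)
  have "card (bnbrs u) \<le> card (insert x (far x y z))"
    using nbrs_of_blue_nbr[OF assms u] bnbrs_subset_nbrs finite_far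
    by (intro card_mono) auto
  also have "\<dots> \<le> Suc (card (far x y z))"
    by (rule card_insert_le_m1) auto
  finally show ?thesis
    using blue_degree_eq[OF u] by simp
qed simp

text \<open>The triangle, the three blue neighbourhoods and the far set cover \<open>V\<close>. With
  \<open>f\<close> far vertices this gives at most 3 + 3(f + 1) + f = 4f + 6.\<close>

lemma card_V_le:
  assumes "triangle x y z" "finite triangle_verts"
  shows "card V \<le> 4 * card triangle_verts + 6"
proof -
  note t = assms(1) triangle_permute(1,2)[OF assms(1)]
  have "V \<subseteq> {x, y, z} \<union> (bnbrs x \<union> (bnbrs y \<union> (bnbrs z \<union> far x y z)))"
    using nbrs_triangle[OF t(1)] nbrs_triangle[OF t(2)] nbrs_triangle[OF t(3)]
    unfolding far_def by blast
  then have "card V \<le> card ({x, y, z} \<union> (bnbrs x \<union> (bnbrs y \<union> (bnbrs z \<union> far x y z))))"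
    by (rule card_mono[rotated]) (simp add: finite_bnbrs finite_far)
  also have "\<dots> \<le> card {x, y, z} + (card (bnbrs x) + (card (bnbrs y) +
      (card (bnbrs z) + card (far x y z))))"
    by (meson card_Un_le add_left_mono order_trans)
  also have "\<dots> \<le> 3 + 3 * Suc (card (far x y z)) + card (far x y z)"
    using card_bnbrs_le[OF t(1)] card_bnbrs_le[OF t(2)] card_bnbrs_le[OF t(3)]
      card_insert_le_m1[of 3 "{y, z}" x] card_insert_le_m1[of 2 "{z}" y]
    by (simp add: far_permute)
  also have "card (far x y z) \<le> card triangle_verts"
    by (rule card_mono[OF assms(2) far_subset_triangle_verts[OF assms(1)]])
  finally show ?thesis
    by simp
qed

end

section \<open>Concrete copies of the diamond and of the triangle\<close>

lemma simple_graph_edge: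
  assumes "simple_graph G" "{u, v} \<in> edges G"
  shows "u \<in> verts G" "v \<in> verts G" "u \<noteq> v"
  using assms by (auto simp: simple_graph_def)

text \<open>The naming follows the shape: \<open>p\<close>, \<open>q\<close> are the ends of the
  chord, matching 0 and 2, and \<open>r\<close>, \<open>s\<close> are the tips, matching 1 and
  3.\<close>

lemma diamond_copy_obtain:
  assumes "S \<in> copies diamond G"
  obtains p q r s where "distinct [p, q, r, s]" "{p, q} \<in> edges G" "{p, r} \<in> edges G"
    "{p, s} \<in> edges G" "{q, r} \<in> edges G" "{q, s} \<in> edges G" "{p, q, r, s} \<subseteq> verts G"
proof -
  obtain f where f: "bij_betw f (verts S) {0, 1, 2, 3}"
    and adj: "\<And>u v. \<lbrakk>u \<in> verts S; v \<in> verts S\<rbrakk> \<Longrightarrow>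
      adjacent S u v \<longleftrightarrow> adjacent diamond (f u) (f v)"
    and S: "edges S \<subseteq> edges G" "verts S \<subseteq> verts G"
    using assms by (auto simp: copies_def subgraph_def isomorphic_def diamond_eq)
  have "\<exists>u\<in>verts S. f u = i" if "i \<in> {0, 1, 2, 3}" for i
    using f that unfolding bij_betw_def by (metis imageE)
  then obtain p q r s where V: "p \<in> verts S" "q \<in> verts S" "r \<in> verts S" "s \<in> verts S"
    and fv: "f p = 0" "f q = 2" "f r = 1" "f s = 3"
    by (metis insertCI)
  have "distinct [p, q, r, s]"
    using fv by auto
  then show ?thesis
    using that[of p q r s] V fv S adj[of p q] adj[of p r] adj[of p s] adj[of q r] adj[of q s]
    by (auto simp: adjacent_def diamond_eq doubleton_eq_iff)
qed

text \<open>Copies need not be induced, so \<open>{r, s}\<close> may itself be an edge of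
  \<open>G\<close>. The explicit form lets later arguments read off the vertex set.\<close>

lemma diamond_copy:
  assumes "distinct [p, q, r, s]" "{p, q, r, s} \<subseteq> verts G"
    and "{p, q} \<in> edges G" "{p, r} \<in> edges G" "{p, s} \<in> edges G"
    "{q, r} \<in> edges G" "{q, s} \<in> edges G"
  shows "({p, q, r, s}, {{p, q}, {p, r}, {p, s}, {q, r}, {q, s}}) \<in> copies diamond G"
proof -
  let ?S = "({p, q, r, s}, {{p, q}, {p, r}, {p, s}, {q, r}, {q, s}})"
  define f :: "'a \<Rightarrow> nat" where
    "f v = (if v = p then 0 else if v = q then 2 else if v = r then 1 else 3)" for v
  have f: "f p = 0" "f q = 2" "f r = 1" "f s = 3"
    using assms(1) by (auto simp: f_def)
  have "bij_betw f (verts ?S) (verts diamond)"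
    using f by (auto simp: bij_betw_def inj_on_def diamond_eq)
  moreover have "\<forall>u\<in>verts ?S. \<forall>v\<in>verts ?S. adjacent ?S u v \<longleftrightarrow> adjacent diamond (f u) (f v)"
    using assms(1) by (simp add: adjacent_def diamond_eq f doubleton_eq_iff) auto
  ultimately have "isomorphic ?S diamond"
    unfolding isomorphic_def by blast
  moreover have "subgraph ?S G"
    using assms by (auto simp: subgraph_def simple_graph_def card_2_iff)
  ultimately show ?thesis
    by (simp add: copies_def)
qed

lemma triangle_copy_obtain:
  assumes "S \<in> triangles G"
  obtains x y z where "{x, y} \<in> edges G" "{y, z} \<in> edges G" "{x, z} \<in> edges G"
proof -
  obtain f where f: "bij_betw f (verts S) {..<3::nat}"
    and adj: "\<And>u v. \<lbrakk>u \<in> verts S; v \<in> verts S\<rbrakk> \<Longrightarrow>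
      adjacent S u v \<longleftrightarrow> adjacent (complete_graph 3) (f u) (f v)"
    and S: "edges S \<subseteq> edges G"
    using assms by (auto simp: triangles_def copies_def subgraph_def isomorphic_def
        complete_graph_def)
  have "\<exists>u\<in>verts S. f u = i" if "i < 3" for i
    using f that unfolding bij_betw_def by (metis imageE lessThan_iff)
  from this[of 0] this[of 1] this[of 2] obtain x y z
    where "x \<in> verts S" "y \<in> verts S" "z \<in> verts S" and "f x = 0" "f y = 1" "f z = 2"
    by auto
  then show ?thesis
    using that[of x y z] S adj[of x y] adj[of y z] adj[of x z]
    by (auto simp: adjacent_def complete_graph_def)
qed

lemma triangle_copy:
  assumes "simple_graph G" "{x, y} \<in> edges G" "{y, z} \<in> edges G" "{x, z} \<in> edges G"
  shows "({x, y, z}, {{x, y}, {y, z}, {x, z}}) \<in> triangles G"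
proof -
  let ?S = "({x, y, z}, {{x, y}, {y, z}, {x, z}})"
  have d: "x \<noteq> y" "y \<noteq> z" "x \<noteq> z" and V: "{x, y, z} \<subseteq> verts G"
    using simple_graph_edge[OF assms(1)] assms(2-4) by blast+
  define f :: "'a \<Rightarrow> nat" where "f v = (if v = x then 0 else if v = y then 1 else 2)" for v
  have f: "f x = 0" "f y = 1" "f z = 2"
    using d by (auto simp: f_def)
  have "bij_betw f (verts ?S) (verts (complete_graph 3))"
    using f by (auto simp: bij_betw_def inj_on_def complete_graph_def)
  moreover have "\<forall>u\<in>verts ?S. \<forall>v\<in>verts ?S.
      adjacent ?S u v \<longleftrightarrow> adjacent (complete_graph 3) (f u) (f v)"
    using d by (simp add: adjacent_def complete_graph_def f doubleton_eq_iff)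
  ultimately have "isomorphic ?S (complete_graph 3)"
    unfolding isomorphic_def by blast
  moreover have "subgraph ?S G"
    using assms d V by (auto simp: subgraph_def simple_graph_def card_2_iff)
  ultimately show ?thesis
    by (simp add: triangles_def copies_def)
qed

section \<open>From unique saturation to the axioms\<close>

lemma diamond_free_apex_unique:
  assumes "simple_graph G" "copies diamond G = {}"
    and "{u, v} \<in> edges G" "{u, p} \<in> edges G" "{v, p} \<in> edges G"
    "{u, q} \<in> edges G" "{v, q} \<in> edges G"
  shows "p = q"
proof (rule ccontr)
  assume "p \<noteq> q"
  then have "distinct [u, v, p, q]" "{u, v, p, q} \<subseteq> verts G"
    using simple_graph_edge[OF assms(1)] assms(3-) by auto
  then show False
    using diamond_copy[of u v p q G] assms by auto
qed

text \<open>Vertex sets are enough to tell the competing copies apart, so edge sets never have to be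
  compared.\<close>

lemma uniquely_saturated_verts_eq:
  assumes "simple_graph G" "uniquely_saturated diamond G"
    and "u \<in> verts G" "v \<in> verts G" "u \<noteq> v" "{u, v} \<notin> edges G"
    and "S \<in> copies diamond (add_edge G u v)" "S' \<in> copies diamond (add_edge G u v)"
  shows "verts S = verts S'"
  using assms unfolding uniquely_saturated_def adjacent_def by metis

lemma diamond_saturated_if_uniquely_saturated:
  assumes G: "simple_graph G" and sat: "uniquely_saturated diamond G"
  shows "diamond_saturated (verts G) (adjacent G)"
proof -
  have free: "copies diamond G = {}"
    using sat by (simp add: uniquely_saturated_def)
  note edge = simple_graph_edge[OF G]
  note apex = diamond_free_apex_unique[OF G free]
  \<comment> \<open>Here the added edge is the chord, and \<open>p\<close>, \<open>q\<close> are the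
    tips.\<close>
  have spine: "verts S = {u, v, p, q}"
    if "u \<noteq> v" "{u, v} \<notin> edges G" "{u, p} \<in> edges G" "{v, p} \<in> edges G"
      "{u, q} \<in> edges G" "{v, q} \<in> edges G" "p \<noteq> q" "S \<in> copies diamond (add_edge G u v)"
    for u v p q S
  proof -
    have "({u, v, p, q}, {{u, v}, {u, p}, {u, q}, {v, p}, {v, q}})
        \<in> copies diamond (add_edge G u v)"
      using that edge[OF that(3)] edge[OF that(4)] edge[OF that(5)] edge[OF that(6)]
      by (intro diamond_copy) (auto simp: add_edge_def)
    from uniquely_saturated_verts_eq[OF G sat _ _ that(1,2,8) this] show ?thesis
      using edge that by auto
  qed
  \<comment> \<open>Here the added edge is a side: the chord is \<open>{u, p}\<close> and the tips
    are \<open>v\<close> and \<open>t\<close>.\<close>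
  have rim: "verts S = {u, v, p, t}"
    if "u \<noteq> v" "{u, v} \<notin> edges G" "{u, p} \<in> edges G" "{v, p} \<in> edges G"
      "{u, t} \<in> edges G" "{p, t} \<in> edges G" "S \<in> copies diamond (add_edge G u v)"
    for u v p t S
  proof -
    have "t \<noteq> v"
      using that by auto
    then have "({u, p, v, t}, {{u, p}, {u, v}, {u, t}, {p, v}, {p, t}})
        \<in> copies diamond (add_edge G u v)"
      using that edge[OF that(3)] edge[OF that(4)] edge[OF that(5)] edge[OF that(6)]
      by (intro diamond_copy) (auto simp: add_edge_def insert_commute)
    from uniquely_saturated_verts_eq[OF G sat _ _ that(1,2,7) this] show ?thesis
      using edge that by auto
  qed
  have ex: "\<exists>S. S \<in> copies diamond (add_edge G u v)"
    if "u \<in> verts G" "v \<in> verts G" "u \<noteq> v" "{u, v} \<notin> edges G" for u v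
    using sat that unfolding uniquely_saturated_def adjacent_def by blast
  show ?thesis
    unfolding diamond_saturated_def adjacent_def
  proof (intro conjI allI impI)
    show "finite (verts G)"
      using G by (simp add: simple_graph_def)
    show "{v, u} \<in> edges G" if "{u, v} \<in> edges G" for u v
      using that by (simp add: insert_commute)
    show "{u, u} \<notin> edges G" for u
      using edge(3) by blast
    show "u \<in> verts G" if "{u, v} \<in> edges G" for u v
      using edge(1) that .
    show "p = q" if "{u, v} \<in> edges G" "{u, p} \<in> edges G" "{v, p} \<in> edges G"
      "{u, q} \<in> edges G" "{v, q} \<in> edges G" for u v p q
      using apex that .
    show "(\<exists>p q. p \<noteq> q \<and> {u, p} \<in> edges G \<and> {v, p} \<in> edges G \<and>
          {u, q} \<in> edges G \<and> {v, q} \<in> edges G) \<or>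
        (\<exists>p t. {u, p} \<in> edges G \<and> {v, p} \<in> edges G \<and> {p, t} \<in> edges G \<and>
          ({u, t} \<in> edges G \<or> {v, t} \<in> edges G))"
      if uv: "u \<in> verts G" "v \<in> verts G" "u \<noteq> v" "{u, v} \<notin> edges G" for u v
    proof -
      obtain S where "S \<in> copies diamond (add_edge G u v)"
        using ex[OF uv] by blast
      then obtain p q r s where d: "distinct [p, q, r, s]" "{p, q, r, s} \<subseteq> verts G"
        and e: "{p, q} \<in> insert {u, v} (edges G)" "{p, r} \<in> insert {u, v} (edges G)"
        "{p, s} \<in> insert {u, v} (edges G)" "{q, r} \<in> insert {u, v} (edges G)"
        "{q, s} \<in> insert {u, v} (edges G)"
        by (rule diamond_copy_obtain) (simp add: add_edge_def)
      have not_all: "\<not> ({p, q} \<in> edges G \<and> {p, r} \<in> edges G \<and> {p, s} \<in> edges G \<and>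
          {q, r} \<in> edges G \<and> {q, s} \<in> edges G)"
        using diamond_copy[OF d] free by blast
      define A where "A a b \<longleftrightarrow> {a, b} \<in> edges G" for a b
      have A_commute: "A a b \<longleftrightarrow> A b a" for a b
        by (simp add: A_def insert_commute)
      have A: "A a b \<or> a = u \<and> b = v \<or> a = v \<and> b = u"
        if "{a, b} \<in> insert {u, v} (edges G)" for a b
        using that by (auto simp: A_def doubleton_eq_iff)
      have ne: "p \<noteq> q" "p \<noteq> r" "p \<noteq> s" "q \<noteq> r" "q \<noteq> s" "r \<noteq> s"
        using d(1) by auto
      note eA = e[THEN A]
      \<comment> \<open>As \<open>G\<close> has no diamond, the new edge is one of the five edges of
        the copy. As the chord it gives the first alternative; as a side, the opposite end of the
        chord is the common neighbour and the other tip serves as \<open>t\<close>.\<close>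
      consider "\<not> A p q" | "\<not> A p r" | "\<not> A p s" | "\<not> A q r" | "\<not> A q s"
        using not_all unfolding A_def by blast
      then show ?thesis
      proof cases
        case 1
        then have "(p = u \<and> q = v \<or> p = v \<and> q = u) \<and> A p r \<and> A p s \<and> A q r \<and> A q s"
          using eA ne by metis
        then show ?thesis
          using ne(6) unfolding A_def[symmetric] by blast
      next
        case 2
        then have "(p = u \<and> r = v \<or> p = v \<and> r = u) \<and> A p q \<and> A p s \<and> A q r \<and> A q s"
          using eA ne by metis
        then show ?thesis
          using A_commute[of q r] unfolding A_def[symmetric] by blast
      next
        case 3
        then have "(p = u \<and> s = v \<or> p = v \<and> s = u) \<and> A p q \<and> A p r \<and> A q r \<and> A q s"
          using eA ne by metis
        then show ?thesis
          using A_commute[of q s] unfolding A_def[symmetric] by blast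
      next
        case 4
        then have "(q = u \<and> r = v \<or> q = v \<and> r = u) \<and> A p q \<and> A p r \<and> A p s \<and> A q s"
          using eA ne by metis
        then show ?thesis
          using A_commute[of p q] A_commute[of p r] unfolding A_def[symmetric] by blast
      next
        case 5
        then have "(q = u \<and> s = v \<or> q = v \<and> s = u) \<and> A p q \<and> A p r \<and> A p s \<and> A q r"
          using eA ne by metis
        then show ?thesis
          using A_commute[of p q] A_commute[of p s] unfolding A_def[symmetric] by blast
      qed
    qed
    show "p = q \<or> p = r \<or> q = r"
      if h: "u \<noteq> v" "{u, v} \<notin> edges G" "{u, p} \<in> edges G" "{v, p} \<in> edges G"
        "{u, q} \<in> edges G" "{v, q} \<in> edges G" "{u, r} \<in> edges G" "{v, r} \<in> edges G"
      for u v p q r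
    proof (rule ccontr)
      assume ne: "\<not> (p = q \<or> p = r \<or> q = r)"
      obtain S where "S \<in> copies diamond (add_edge G u v)"
        using ex[OF edge(1)[OF h(3)] edge(1)[OF h(4)] h(1,2)] by blast
      then have "{u, v, p, q} = {u, v, p, r}"
        using spine[OF h(1-6)] spine[OF h(1-4,7,8)] ne by metis
      then show False
        using ne edge(3)[OF h(5)] edge(3)[OF h(6)] by auto
    qed
    show "p = q"
      if h: "u \<noteq> v" "{u, v} \<notin> edges G" "{u, p} \<in> edges G" "{v, p} \<in> edges G"
        "{u, t} \<in> edges G" "{p, t} \<in> edges G" "{u, q} \<in> edges G" "{v, q} \<in> edges G"
      for u v p t q
    proof (rule ccontr)
      assume ne: "p \<noteq> q"
      obtain S where "S \<in> copies diamond (add_edge G u v)"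
        using ex[OF edge(1)[OF h(3)] edge(1)[OF h(4)] h(1,2)] by blast
      then have "{u, v, p, q} = {u, v, p, t}"
        using spine[OF h(1-4,7,8) ne] rim[OF h(1-6)] by metis
      then have "q = t"
        using ne edge(3)[OF h(7)] edge(3)[OF h(8)] by auto
      \<comment> \<open>Now \<open>{p, t}\<close> has both \<open>u\<close> and \<open>v\<close> as
        apexes, which forces \<open>u = v\<close>.\<close>
      then show False
        using apex[of p t u v] h by (simp add: insert_commute)
    qed
    show False
      if h: "u \<noteq> v" "{u, v} \<notin> edges G" "{u, p} \<in> edges G" "{v, p} \<in> edges G"
        "{u, t} \<in> edges G" "{p, t} \<in> edges G" "{v, s} \<in> edges G" "{p, s} \<in> edges G"
      for u v p t s
    proof -
      obtain S where "S \<in> copies diamond (add_edge G u v)"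
        using ex[OF edge(1)[OF h(3)] edge(1)[OF h(4)] h(1,2)] by blast
      moreover have "add_edge G v u = add_edge G u v"
        by (simp add: add_edge_def insert_commute)
      moreover have "{v, u} \<notin> edges G"
        using h(2) by (simp add: insert_commute)
      \<comment> \<open>The rim copy is formed once from \<open>u\<close> and once from
        \<open>v\<close>; equal vertex sets give \<open>s = t\<close>, and again an edge with two
        apexes.\<close>
      ultimately have "{u, v, p, t} = {v, u, p, s}"
        using rim[OF h(1-6)] rim[OF h(1)[symmetric] _ h(4,3,7,8)] by metis
      then have "s = t"
        using edge(3)[OF h(7)] edge(3)[OF h(8)] h(2,5,7) by (auto simp: insert_commute)
      then show False
        using apex[of p t u v] h by (simp add: insert_commute)
    qed
  qed
qed

section \<open>Counting by triangles and the final estimate\<close>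

lemma card_triangle_verts_le:
  assumes "simple_graph G" "uniquely_saturated diamond G" "finite (triangles G)"
  shows "finite (diamond_saturated.triangle_verts (adjacent G))"
    and "card (diamond_saturated.triangle_verts (adjacent G)) \<le> 3 * card (triangles G)"
proof -
  interpret diamond_saturated "verts G" "adjacent G"
    using diamond_saturated_if_uniquely_saturated[OF assms(1,2)] .
  \<comment> \<open>Each end of a red edge lies in the vertex set of some triangle copy, and each
    copy has three vertices.\<close>
  have sub: "triangle_verts \<subseteq> (\<Union>S\<in>triangles G. verts S)"
  proof
    fix u assume "u \<in> triangle_verts"
    then obtain v t where "{u, v} \<in> edges G" "{v, t} \<in> edges G" "{u, t} \<in> edges G"
      by (auto simp: triangle_verts_def red_def adjacent_def)
    from triangle_copy[OF assms(1) this] show "u \<in> (\<Union>S\<in>triangles G. verts S)"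
      by force
  qed
  have card: "card (verts S) = 3" if "S \<in> triangles G" for S
    using that bij_betw_same_card
    by (fastforce simp: triangles_def copies_def isomorphic_def complete_graph_def)
  have "finite (verts S)" if "S \<in> triangles G" for S
    using card[OF that] by (simp add: card_ge_0_finite)
  then have fin: "finite (\<Union>S\<in>triangles G. verts S)"
    using assms(3) by blast
  show "finite triangle_verts"
    using finite_subset[OF sub fin] .
  have "card triangle_verts \<le> card (\<Union>S\<in>triangles G. verts S)"
    using card_mono[OF fin sub] .
  also have "\<dots> \<le> (\<Sum>S\<in>triangles G. card (verts S))"
    by (rule card_UN_le[OF assms(3)])
  also have "\<dots> = 3 * card (triangles G)"
    using card by simp
  finally show "card triangle_verts \<le> 3 * card (triangles G)" .
qed

lemma card_verts_le:
  assumes "simple_graph G" "uniquely_saturated diamond G" "card (triangles G) > 0"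
  shows "card (verts G) \<le> 12 * card (triangles G) + 6"
proof -
  interpret diamond_saturated "verts G" "adjacent G"
    using diamond_saturated_if_uniquely_saturated[OF assms(1,2)] .
  \<comment> \<open>Infinite sets have cardinality 0, so a positive count gives finiteness as well
    as a triangle to start from.\<close>
  have fin: "finite (triangles G)"
    using assms(3) by (rule card_ge_0_finite)
  obtain S where "S \<in> triangles G"
    using assms(3) by (metis card.empty ex_in_conv less_irrefl)
  then obtain x y z where "triangle x y z"
    by (rule triangle_copy_obtain) (simp add: triangle_def adjacent_def)
  from card_V_le[OF this] show ?thesis
    using card_triangle_verts_le[OF assms(1,2) fin] by linarith
qed

theorem theorem3p5:
  fixes k n :: nat
  assumes "k \<ge> 2"
    and "int n > 18 * (int k)\<^sup>2 - 24 * int k + 10"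
  shows "\<not> (\<exists>G :: 'a graph. simple_graph G \<and> card (verts G) = n \<and>
             uniquely_saturated diamond G \<and> card (triangles G) = k)"
proof
  assume "\<exists>G :: 'a graph. simple_graph G \<and> card (verts G) = n \<and>
      uniquely_saturated diamond G \<and> card (triangles G) = k"
  then have "n \<le> 12 * k + 6"
    using card_verts_le assms(1) by fastforce
  \<comment> \<open>This turns the assumed lower bound on \<open>n\<close> into at least 36k - 24k +
    10 = 12k + 10, above the linear bound 12k + 6.\<close>
  moreover have "(int k)\<^sup>2 \<ge> 2 * int k"
    using assms(1) by (simp add: power2_eq_square)
  ultimately show False
    using assms(2) by linarith
qed

end
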